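(* The Vaidya-Bonner-de Sitter spacetime with $q^2-rm\neq0$ is neither a Ricci generalized pseudosymmetric manifold nor a pseudosymmetric manifold, but (i) it admits $C\cdot C=-\frac{rm-q^2}{r^4}\,Q(g,C)$; (ii) it satisfies the curvature condition $R\cdot R+\beta\,Q(g,C)=Q(S,R)$, where $\beta=\frac{2r^5\lambda m+3r^2m^2-2r^4\lambda q^2-6rmq^2+2q^4}{3r^4(rm-q^2)}$.
   Context: The Vaidya-Bonner-de Sitter (VBdS) spacetime is the $4$-dimensional Lorentzian manifold with coordinates $(x^1,x^2,x^3,x^4)=(t,r,\theta,\phi)$ and metric $ds^2=\left(1-\frac{2m(t)}{r}+\frac{q^2(t)}{r^2}-\frac{\lambda r^2}{3}\right)dt^2-2\,dt\,dr-r^2(d\theta^2+\sin^2\theta\, d\phi^2)$, where $\lambda$ is a constant and the mass $m=m(t)$ and charge $q=q(t)$ are smooth functions depending on $t$. Curvature conventions: $R_{efst}=g_{e\alpha}(\partial_s\Gamma^\alpha_{ft}-\partial_t\Gamma^\alpha_{fs}+\Gamma^\beta_{ft}\Gamma^\alpha_{\beta s}-\Gamma^\beta_{fs}\Gamma^\alpha_{\beta t})$, $S_{fs}=g^{et}R_{efst}$, $\bar\kappa=g^{fs}S_{fs}$. With $(X\wedge Z)_{efst}=X_{et}Z_{fs}+X_{fs}Z_{et}-X_{es}Z_{ft}-X_{ft}Z_{es}$, the Weyl conformal curvature tensor is $C=R-\frac12 g\wedge S+\frac{\bar\kappa}{12}g\wedge g$. For a $(0,m)$ tensor $W$, a $(0,4)$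 curvature-type tensor $L$ (first index raised by $g$) and a symmetric $(0,2)$ tensor $\beta$: $(L\cdot W)_{b_1\cdots b_m rs}=-[L^\alpha{}_{b_1 rs}W_{\alpha b_2\cdots b_m}+\cdots+L^\alpha{}_{b_m rs}W_{b_1\cdots b_{m-1}\alpha}]$ and $Q(\beta,W)_{b_1\cdots b_m rs}=\beta_{sb_1}W_{rb_2\cdots b_m}+\cdots+\beta_{sb_m}W_{b_1\cdots b_{m-1}r}-\beta_{rb_1}W_{sb_2\cdots b_m}-\cdots-\beta_{rb_m}W_{b_1\cdots b_{m-1}s}$. The manifold is pseudosymmetric (in the sense of Deszcz) if $R\cdot R=\mathscr F\,Q(g,R)$ for a smooth function $\mathscr F$ on the set where $Q(g,R)\neq0$, and Ricci generalized pseudosymmetric if $R\cdot R=\mathscr F\,Q(S,R)$ for a smooth function $\mathscr F$ on the set where $Q(S,R)\neq0$. *)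

theory Defs
  imports "HOL-Analysis.Analysis"
begin

text \<open>Smoothness (all orders) on an open set, by iterated directional derivatives. For
  functions of one real variable this is infinite differentiability.\<close>

fun Ck_on :: "nat \<Rightarrow> ('a::real_normed_vector) set \<Rightarrow> ('a \<Rightarrow> 'b::real_normed_vector) \<Rightarrow> bool" where
  "Ck_on 0 U f \<longleftrightarrow> continuous_on U f"
| "Ck_on (Suc k) U f \<longleftrightarrow>
     (\<forall>x\<in>U. f differentiable (at x)) \<and> (\<forall>v. Ck_on k U (\<lambda>x. frechet_derivative f (at x) v))"

definition smooth_on :: "('a::real_normed_vector) set \<Rightarrow> ('a \<Rightarrow> 'b::real_normed_vector) \<Rightarrow> bool" where
  "smooth_on U f \<longleftrightarrow> (\<forall>k. Ck_on k U f)"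

definition partial :: "'n::finite \<Rightarrow> (real^'n \<Rightarrow> real) \<Rightarrow> real^'n \<Rightarrow> real" where
  "partial i f x = deriv (\<lambda>h. f (x + h *\<^sub>R axis i 1)) 0"

text \<open>A metric is given by its component matrix in one chart. Tensors are represented by their
  covariant components in that chart: \<open>(0,2)\<close> tensors at a point as matrices, \<open>(0,4)\<close> and
  \<open>(0,6)\<close> tensors at a point as functions of their indices.\<close>

type_synonym 'n metric = "real^'n \<Rightarrow> real^'n^'n"
type_synonym 'n tensor4 = "'n \<Rightarrow> 'n \<Rightarrow> 'n \<Rightarrow> 'n \<Rightarrow> real"
type_synonym 'n tensor6 = "'n \<Rightarrow> 'n \<Rightarrow> 'n \<Rightarrow> 'n \<Rightarrow> 'n \<Rightarrow> 'n \<Rightarrow> real"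

text \<open>\<open>christoffel g x h i j\<close> is the Levi-Civita symbol with upper index \<open>h\<close> and lower
  indices \<open>i\<close>, \<open>j\<close>.\<close>

definition christoffel :: "'n::finite metric \<Rightarrow> real^'n \<Rightarrow> 'n \<Rightarrow> 'n \<Rightarrow> 'n \<Rightarrow> real" where
  "christoffel g x h i j =
     1 / 2 * (\<Sum>k\<in>UNIV. matrix_inv (g x) $ h $ k *
       (partial i (\<lambda>y. g y $ j $ k) x + partial j (\<lambda>y. g y $ i $ k) x
        - partial k (\<lambda>y. g y $ i $ j) x))"

definition riemann :: "'n::finite metric \<Rightarrow> real^'n \<Rightarrow> 'n tensor4" where
  "riemann g x e f s t =
     (\<Sum>a\<in>UNIV. g x $ e $ a *
       (partial s (\<lambda>y. christoffel g y a f t) x - partial t (\<lambda>y. christoffel g y a f s) x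
        + (\<Sum>b\<in>UNIV. christoffel g x b f t * christoffel g x a b s)
        - (\<Sum>b\<in>UNIV. christoffel g x b f s * christoffel g x a b t)))"

text \<open>The trace is over the first and last index, so the Ricci tensor is the negative of the one
  obtained by contracting the first and third index.\<close>

definition ricci :: "'n::finite metric \<Rightarrow> real^'n \<Rightarrow> real^'n^'n" where
  "ricci g x = (\<chi> f s. \<Sum>e\<in>UNIV. \<Sum>t\<in>UNIV. matrix_inv (g x) $ e $ t * riemann g x e f s t)"

definition scalar_curv :: "'n::finite metric \<Rightarrow> real^'n \<Rightarrow> real" where
  "scalar_curv g x = (\<Sum>f\<in>UNIV. \<Sum>s\<in>UNIV. matrix_inv (g x) $ f $ s * ricci g x $ f $ s)"

definition kulkarni_nomizu :: "real^'n^'n \<Rightarrow> real^'n^'n \<Rightarrow> 'n::finite tensor4" where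
  "kulkarni_nomizu X Z e f s t =
     X $ e $ t * Z $ f $ s + X $ f $ s * Z $ e $ t - X $ e $ s * Z $ f $ t - X $ f $ t * Z $ e $ s"

text \<open>The coefficients are those of dimension four.\<close>

definition weyl :: "4 metric \<Rightarrow> real^4 \<Rightarrow> 4 tensor4" where
  "weyl g x e f s t =
     riemann g x e f s t - 1 / 2 * kulkarni_nomizu (g x) (ricci g x) e f s t
     + scalar_curv g x / 12 * kulkarni_nomizu (g x) (g x) e f s t"

text \<open>\<open>curv_dot G L W\<close> is \<open>L \<cdot> W\<close>, with \<open>G\<close> the metric at the point under consideration, and
  \<open>tachibana B W\<close> is \<open>Q(B, W)\<close>. In both, \<open>r\<close> and \<open>s\<close> are the two new indices.\<close>

definition raise_first :: "real^'n^'n \<Rightarrow> 'n tensor4 \<Rightarrow> 'n::finite tensor4" where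
  "raise_first G L a b r s = (\<Sum>e\<in>UNIV. matrix_inv G $ a $ e * L e b r s)"

definition curv_dot :: "real^'n^'n \<Rightarrow> 'n tensor4 \<Rightarrow> 'n tensor4 \<Rightarrow> 'n::finite tensor6" where
  "curv_dot G L W b1 b2 b3 b4 r s =
     - (\<Sum>a\<in>UNIV. raise_first G L a b1 r s * W a b2 b3 b4
                 + raise_first G L a b2 r s * W b1 a b3 b4
                 + raise_first G L a b3 r s * W b1 b2 a b4
                 + raise_first G L a b4 r s * W b1 b2 b3 a)"

definition tachibana :: "real^'n^'n \<Rightarrow> 'n tensor4 \<Rightarrow> 'n::finite tensor6" where
  "tachibana B W b1 b2 b3 b4 r s =
     B $ s $ b1 * W r b2 b3 b4 + B $ s $ b2 * W b1 r b3 b4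
     + B $ s $ b3 * W b1 b2 r b4 + B $ s $ b4 * W b1 b2 b3 r
     - B $ r $ b1 * W s b2 b3 b4 - B $ r $ b2 * W b1 s b3 b4
     - B $ r $ b3 * W b1 b2 s b4 - B $ r $ b4 * W b1 b2 b3 s"

definition pseudosymmetric_on :: "(real^'n) set \<Rightarrow> 'n::finite metric \<Rightarrow> bool" where
  "pseudosymmetric_on M g \<longleftrightarrow>
     (let U = {x\<in>M. tachibana (g x) (riemann g x) \<noteq> (\<lambda>b1 b2 b3 b4 r s. 0)} in
      \<exists>F. smooth_on U F \<and>
        (\<forall>x\<in>U. \<forall>b1 b2 b3 b4 r s. curv_dot (g x) (riemann g x) (riemann g x) b1 b2 b3 b4 r s
           = F x * tachibana (g x) (riemann g x) b1 b2 b3 b4 r s))"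

definition ricci_gen_pseudosymmetric_on :: "(real^'n) set \<Rightarrow> 'n::finite metric \<Rightarrow> bool" where
  "ricci_gen_pseudosymmetric_on M g \<longleftrightarrow>
     (let U = {x\<in>M. tachibana (ricci g x) (riemann g x) \<noteq> (\<lambda>b1 b2 b3 b4 r s. 0)} in
      \<exists>F. smooth_on U F \<and>
        (\<forall>x\<in>U. \<forall>b1 b2 b3 b4 r s. curv_dot (g x) (riemann g x) (riemann g x) b1 b2 b3 b4 r s
           = F x * tachibana (ricci g x) (riemann g x) b1 b2 b3 b4 r s))"

text \<open>The coordinates \<open>(t, r, \<theta>, \<phi>)\<close> are \<open>(x $ 1, x $ 2, x $ 3, x $ 4)\<close>. The off-diagonal entry
  of \<open>vbds_metric\<close> is \<open>-1\<close> because the term \<open>- 2 dt dr\<close> is split between two entries.\<close>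

definition vbds_metric :: "(real \<Rightarrow> real) \<Rightarrow> (real \<Rightarrow> real) \<Rightarrow> real \<Rightarrow> 4 metric" where
  "vbds_metric m q lam x =
     (let t = x $ 1; r = x $ 2; \<theta> = x $ 3 in
      vector [vector [1 - 2 * m t / r + (q t)\<^sup>2 / r\<^sup>2 - lam * r\<^sup>2 / 3, - 1, 0, 0],
              vector [- 1, 0, 0, 0],
              vector [0, 0, - r\<^sup>2, 0],
              vector [0, 0, 0, - (r\<^sup>2 * (sin \<theta>)\<^sup>2)]])"

text \<open>A coordinate region of the spacetime: \<open>m\<close> and \<open>q\<close> are only required to be
  smooth at the values of \<open>t\<close> that occur. The azimuth \<open>\<phi>\<close> is unrestricted, as nothing
  depends on it.\<close>

definition vbds_spacetime :: "(real^4) set \<Rightarrow> (real \<Rightarrow> real) \<Rightarrow> (real \<Rightarrow> real) \<Rightarrow> bool" where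
  "vbds_spacetime M m q \<longleftrightarrow>
     open M \<and> connected M \<and> M \<noteq> {} \<and> (\<forall>x\<in>M. 0 < x $ 2 \<and> 0 < x $ 3 \<and> x $ 3 < pi) \<and>
     smooth_on ((\<lambda>x. x $ 1) ` M) m \<and> smooth_on ((\<lambda>x. x $ 1) ` M) q"

text \<open>The mass and the charge genuinely depend on \<open>t\<close>: they are not both constant. If both
  are constant, the metric is the static Reissner-Nordstrom-de Sitter metric, which is
  pseudosymmetric.\<close>

definition vbds_time_dependent :: "(real^4) set \<Rightarrow> (real \<Rightarrow> real) \<Rightarrow> (real \<Rightarrow> real) \<Rightarrow> bool" where
  "vbds_time_dependent M m q \<longleftrightarrow>
     \<not> (m constant_on ((\<lambda>x. x $ 1) ` M) \<and> q constant_on ((\<lambda>x. x $ 1) ` M))"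

end

theory Submission
  imports Defs
begin

text \<open>At each point the metric, the Ricci tensor, and the tensors \<open>R\<close> and \<open>C\<close> have the shape of a
  warped product of the \<open>(t, r)\<close>-plane with the sphere. They are determined by \<open>g\<^sub>1\<^sub>1\<close>, \<open>r\<close>, \<open>\<theta>\<close>,
  \<open>l = \<lambda>/3\<close>, \<open>u = m/r^3\<close>, \<open>v = q^2/r^4\<close> and \<open>d = (q q' - r m')/r\<close>, and in these variables (i) and (ii)
  become polynomial identities, which by antisymmetry need to be checked on pairs of indices \<open>i < j\<close> only.

  Where \<open>d \<noteq> 0\<close>, the components \<open>121313\<close> and \<open>121323\<close> exclude both kinds of pseudosymmetry.
  \<open>R\<cdot>R = F Q(g,R)\<close> gives \<open>F = l + 2u - 3v\<close> from the first, and \<open>F = l - u + v\<close> from the second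
  provided that \<open>3u \<noteq> 4v\<close>; these are then different. \<open>R\<cdot>R = F Q(S,R)\<close> gives \<open>F = 1\<close> provided that
  \<open>l + 2u \<noteq> 3v\<close>, and then \<open>\<beta> = 0\<close>. For a fixed \<open>t\<close> with \<open>(m', q q') \<noteq> 0\<close> the exceptional values of
  \<open>r\<close> are the roots of nonzero polynomials, and so can be avoided by moving \<open>r\<close> slightly.\<close>

subsection \<open>Curvature tensors of warped product shape\<close>

lemma vector_4 [simp]:
  "(vector [x, y, z, w] :: 'a::zero^4) $ 1 = x"
  "(vector [x, y, z, w] :: 'a::zero^4) $ 2 = y"
  "(vector [x, y, z, w] :: 'a::zero^4) $ 3 = z"
  "(vector [x, y, z, w] :: 'a::zero^4) $ 4 = w"
  unfolding vector_def by simp_all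

text \<open>The components of the 2-form dx^i \<and> dx^j; products of two of these span the
  curvature tensors considered.\<close>

definition bivector :: "'n \<Rightarrow> 'n \<Rightarrow> 'n \<Rightarrow> 'n \<Rightarrow> real" where
  "bivector i j e f = of_bool (e = i \<and> f = j) - of_bool (e = j \<and> f = i)"

text \<open>The components are \<open>T\<^sub>1\<^sub>2\<^sub>1\<^sub>2 = A\<close>, \<open>T\<^sub>1\<^sub>3\<^sub>1\<^sub>3 = B\<close>, \<open>T\<^sub>1\<^sub>3\<^sub>2\<^sub>3 = E\<close>, \<open>T\<^sub>3\<^sub>4\<^sub>3\<^sub>4 = K s\<close>, and those with a
  pair of indices \<open>4\<close> in place of \<open>3\<close> carry a factor \<open>s\<close>, which is \<open>sin\<^sup>2 \<theta>\<close> in the application.\<close>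

definition warped_curv :: "real \<Rightarrow> real \<Rightarrow> real \<Rightarrow> real \<Rightarrow> real \<Rightarrow> 4 tensor4" where
  "warped_curv A B E K s e f p t =
     A * (bivector 1 2 e f * bivector 1 2 p t)
     + B * (bivector 1 3 e f * bivector 1 3 p t + s * (bivector 1 4 e f * bivector 1 4 p t))
     + E * (bivector 1 3 e f * bivector 2 3 p t + bivector 2 3 e f * bivector 1 3 p t
            + s * (bivector 1 4 e f * bivector 2 4 p t + bivector 2 4 e f * bivector 1 4 p t))
     + K * s * (bivector 3 4 e f * bivector 3 4 p t)"

text \<open>Common shape of the metric and the Ricci tensor: a block on the (t, r)-plane without
  dr^2 term, and \<open>c\<close> times the round metric.\<close>

definition warped_symm :: "real \<Rightarrow> real \<Rightarrow> real \<Rightarrow> real \<Rightarrow> real^4^4" where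
  "warped_symm a b c s =
     vector [vector [a, b, 0, 0], vector [b, 0, 0, 0], vector [0, 0, c, 0], vector [0, 0, 0, c * s]]"

lemma bivector_swap: "bivector i j f e = - bivector i j e f"
  by (simp add: bivector_def conj_commute)

lemma bivector_diag: "bivector i j e e = 0"
  by (simp add: bivector_def conj_commute)

lemma warped_curv_antisym:
  "warped_curv A B E K s f e p t = - warped_curv A B E K s e f p t"
  "warped_curv A B E K s e f t p = - warped_curv A B E K s e f p t"
  unfolding warped_curv_def bivector_swap[of _ _ f e] bivector_swap[of _ _ t p]
  by (simp_all only: mult_minus_left mult_minus_right minus_add_distrib distrib_left)

definition basis_pairs :: "(4 \<times> 4) set" where
  "basis_pairs = {(1, 2), (1, 3), (1, 4), (2, 3), (2, 4), (3, 4)}"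

lemma antisym_eqI:
  fixes T U :: "4 \<Rightarrow> 4 \<Rightarrow> real"
  assumes T: "\<And>i j. T j i = - T i j" and U: "\<And>i j. U j i = - U i j"
    and eq: "\<And>i j. (i, j) \<in> basis_pairs \<Longrightarrow> T i j = U i j"
  shows "T i j = U i j"
proof -
  have "T i i = 0" "U i i = 0"
    using T[of i i] U[of i i] by simp_all
  moreover have "i = j \<or> (i, j) \<in> basis_pairs \<or> (j, i) \<in> basis_pairs"
    using exhaust_4[of i] exhaust_4[of j] by (auto simp: basis_pairs_def)
  moreover have "T i j = U i j" if "(j, i) \<in> basis_pairs"
    unfolding T[of i j] U[of i j] eq[OF that] by (rule refl)
  ultimately show ?thesis
    using eq[of i j] by (elim disjE) simp_all
qed

lemma antisym4_eqI:
  fixes T U :: "4 tensor4"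
  assumes T: "\<And>i j k l. T j i k l = - T i j k l" "\<And>i j k l. T i j l k = - T i j k l"
    and U: "\<And>i j k l. U j i k l = - U i j k l" "\<And>i j k l. U i j l k = - U i j k l"
    and eq: "\<And>i j k l. (i, j) \<in> basis_pairs \<Longrightarrow> (k, l) \<in> basis_pairs \<Longrightarrow> T i j k l = U i j k l"
  shows "T = U"
proof (intro ext)
  fix i j k l
  have *: "T i j k l = U i j k l" if "(i, j) \<in> basis_pairs" for i j
    by (rule antisym_eqI[of "T i j" "U i j"]) (auto intro: T U eq that)
  show "T i j k l = U i j k l"
    by (rule antisym_eqI[of "\<lambda>i j. T i j k l" "\<lambda>i j. U i j k l"]) (auto intro: T U *)
qed

lemma kulkarni_nomizu_antisym:
  "kulkarni_nomizu X Y f e p t = - kulkarni_nomizu X Y e f p t"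
  "kulkarni_nomizu X Y e f t p = - kulkarni_nomizu X Y e f p t"
  by (simp_all add: kulkarni_nomizu_def)

lemma warped_curv_diag:
  "warped_curv A B E K s e e p t = 0" "warped_curv A B E K s e f p p = 0"
  by (simp_all add: warped_curv_def bivector_diag)

lemma warped_curv_basis:
  "warped_curv A B E K s 1 2 1 2 = A" "warped_curv A B E K s 1 2 1 3 = 0"
  "warped_curv A B E K s 1 2 1 4 = 0" "warped_curv A B E K s 1 2 2 3 = 0"
  "warped_curv A B E K s 1 2 2 4 = 0" "warped_curv A B E K s 1 2 3 4 = 0"
  "warped_curv A B E K s 1 3 1 2 = 0" "warped_curv A B E K s 1 3 1 3 = B"
  "warped_curv A B E K s 1 3 1 4 = 0" "warped_curv A B E K s 1 3 2 3 = E"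
  "warped_curv A B E K s 1 3 2 4 = 0" "warped_curv A B E K s 1 3 3 4 = 0"
  "warped_curv A B E K s 1 4 1 2 = 0" "warped_curv A B E K s 1 4 1 3 = 0"
  "warped_curv A B E K s 1 4 1 4 = B * s" "warped_curv A B E K s 1 4 2 3 = 0"
  "warped_curv A B E K s 1 4 2 4 = E * s" "warped_curv A B E K s 1 4 3 4 = 0"
  "warped_curv A B E K s 2 3 1 2 = 0" "warped_curv A B E K s 2 3 1 3 = E"
  "warped_curv A B E K s 2 3 1 4 = 0" "warped_curv A B E K s 2 3 2 3 = 0"
  "warped_curv A B E K s 2 3 2 4 = 0" "warped_curv A B E K s 2 3 3 4 = 0"
  "warped_curv A B E K s 2 4 1 2 = 0" "warped_curv A B E K s 2 4 1 3 = 0"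
  "warped_curv A B E K s 2 4 1 4 = E * s" "warped_curv A B E K s 2 4 2 3 = 0"
  "warped_curv A B E K s 2 4 2 4 = 0" "warped_curv A B E K s 2 4 3 4 = 0"
  "warped_curv A B E K s 3 4 1 2 = 0" "warped_curv A B E K s 3 4 1 3 = 0"
  "warped_curv A B E K s 3 4 1 4 = 0" "warped_curv A B E K s 3 4 2 3 = 0"
  "warped_curv A B E K s 3 4 2 4 = 0" "warped_curv A B E K s 3 4 3 4 = K * s"
  by (simp_all add: warped_curv_def bivector_def)

text \<open>As a general rewrite rule antisymmetry would loop; at concrete indices it sorts each
  pair, so that every component evaluates.\<close>

lemmas warped_curv_table = warped_curv_basis warped_curv_diag
  warped_curv_antisym(1)[where e = 1 and f = 2] warped_curv_antisym(2)[where p = 1 and t = 2]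
  warped_curv_antisym(1)[where e = 1 and f = 3] warped_curv_antisym(2)[where p = 1 and t = 3]
  warped_curv_antisym(1)[where e = 1 and f = 4] warped_curv_antisym(2)[where p = 1 and t = 4]
  warped_curv_antisym(1)[where e = 2 and f = 3] warped_curv_antisym(2)[where p = 2 and t = 3]
  warped_curv_antisym(1)[where e = 2 and f = 4] warped_curv_antisym(2)[where p = 2 and t = 4]
  warped_curv_antisym(1)[where e = 3 and f = 4] warped_curv_antisym(2)[where p = 3 and t = 4]

lemma warped_symm_table:
  "warped_symm a b c s $ 1 $ 1 = a" "warped_symm a b c s $ 1 $ 2 = b"
  "warped_symm a b c s $ 1 $ 3 = 0" "warped_symm a b c s $ 1 $ 4 = 0"
  "warped_symm a b c s $ 2 $ 1 = b" "warped_symm a b c s $ 2 $ 2 = 0"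
  "warped_symm a b c s $ 2 $ 3 = 0" "warped_symm a b c s $ 2 $ 4 = 0"
  "warped_symm a b c s $ 3 $ 1 = 0" "warped_symm a b c s $ 3 $ 2 = 0"
  "warped_symm a b c s $ 3 $ 3 = c" "warped_symm a b c s $ 3 $ 4 = 0"
  "warped_symm a b c s $ 4 $ 1 = 0" "warped_symm a b c s $ 4 $ 2 = 0"
  "warped_symm a b c s $ 4 $ 3 = 0" "warped_symm a b c s $ 4 $ 4 = c * s"
  by (simp_all add: warped_symm_def)

text \<open>The warped shape is closed under this product, so the Weyl tensor can be computed on the
  level of coefficients.\<close>

lemma kulkarni_nomizu_warped_symm:
  "kulkarni_nomizu (warped_symm a b c s) (warped_symm a' b' c' s) =
     warped_curv (2 * (b * b')) (- (a * c' + c * a')) (- (b * c' + c * b')) (- (2 * (c * c'))) s"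
  (is "?K = ?W")
proof (rule antisym4_eqI)
  fix i j k l :: 4
  assume "(i, j) \<in> basis_pairs" "(k, l) \<in> basis_pairs"
  then show "?K i j k l = ?W i j k l"
    unfolding basis_pairs_def
    by (elim insertE emptyE Pair_inject; hypsubst)
       (simp_all add: kulkarni_nomizu_def warped_symm_table warped_curv_table algebra_simps)
qed (rule kulkarni_nomizu_antisym warped_curv_antisym)+

section \<open>The inverse metric and raising of an index\<close>

lemma matrix_inv_eqI:
  fixes A B :: "real^'n^'n"
  assumes "A ** B = mat 1" "B ** A = mat 1"
  shows "matrix_inv A = B"
proof -
  \<comment> \<open>\<open>matrix_inv\<close> is a choice among two-sided inverses, and
    \<open>B\<close> witnesses that there is one.\<close>
  have *: "A ** matrix_inv A = mat 1"
    unfolding matrix_inv_def by (rule someI2[of _ B]) (use assms in simp_all)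
  have "matrix_inv A = (B ** A) ** matrix_inv A"
    by (simp only: assms(2) matrix_mul_lid)
  also have "\<dots> = B"
    by (simp only: matrix_mul_assoc[symmetric] * matrix_mul_rid)
  finally show ?thesis .
qed

locale warped_metric_point =
  fixes h p s :: real
  assumes p: "p \<noteq> 0" and s: "s \<noteq> 0"
begin

text \<open>In the application \<open>h = g\<^sub>1\<^sub>1\<close>, \<open>p = r\<^sup>2\<close> and \<open>s = sin\<^sup>2 \<theta>\<close>.\<close>

abbreviation G :: "real^4^4" where
  "G \<equiv> warped_symm h (- 1) (- p) s"

text \<open>The (t, r)-block has determinant -1 whatever \<open>h\<close> is, so the formula also
  covers points where the component 11 of the metric vanishes.\<close>

lemma matrix_inv_G:
  "matrix_inv G = vector [vector [0, - 1, 0, 0], vector [- 1, - h, 0, 0],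
     vector [0, 0, - 1 / p, 0], vector [0, 0, 0, - 1 / (p * s)]]"
  using p s
  by (intro matrix_inv_eqI)
     (simp_all add: vec_eq_iff forall_4 matrix_matrix_mult_def sum_4 mat_def warped_symm_def)

lemma sum_matrix_inv_G:
  "(\<Sum>a\<in>UNIV. matrix_inv G $ 1 $ a * f a) = - f 2"
  "(\<Sum>a\<in>UNIV. matrix_inv G $ 2 $ a * f a) = - f 1 - h * f 2"
  "(\<Sum>a\<in>UNIV. matrix_inv G $ 3 $ a * f a) = - f 3 / p"
  "(\<Sum>a\<in>UNIV. matrix_inv G $ 4 $ a * f a) = - f 4 / (p * s)"
  by (simp_all add: matrix_inv_G sum_4)

lemma raise_first_G:
  "raise_first G L 1 b k l = - L 2 b k l"
  "raise_first G L 2 b k l = - L 1 b k l - h * L 2 b k l"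
  "raise_first G L 3 b k l = - L 3 b k l / p"
  "raise_first G L 4 b k l = - L 4 b k l / (p * s)"
  by (simp_all only: raise_first_def sum_matrix_inv_G)

end

section \<open>Reduction of six-index identities to ordered index pairs\<close>

definition pair_antisym4 :: "4 tensor4 \<Rightarrow> bool" where
  "pair_antisym4 W \<longleftrightarrow>
     (\<forall>a b c d. W b a c d = - W a b c d) \<and> (\<forall>a b c d. W a b d c = - W a b c d)"

definition pair_antisym6 :: "4 tensor6 \<Rightarrow> bool" where
  "pair_antisym6 T \<longleftrightarrow> (\<forall>a b c d k l. T b a c d k l = - T a b c d k l) \<and>
     (\<forall>a b c d k l. T a b d c k l = - T a b c d k l) \<and> (\<forall>a b c d k l. T a b c d l k = - T a b c d k l)"

lemma pair_antisym4D:
  assumes "pair_antisym4 W"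
  shows "W b a c d = - W a b c d" "W a b d c = - W a b c d"
  using assms unfolding pair_antisym4_def by blast+

lemma pair_antisym6D:
  assumes "pair_antisym6 T"
  shows "T b a c d k l = - T a b c d k l" "T a b d c k l = - T a b c d k l"
    "T a b c d l k = - T a b c d k l"
  using assms unfolding pair_antisym6_def by blast+

text \<open>Of the 4096 components only 6^3 = 216 remain to be compared.\<close>

lemma pair_antisym6_eqI:
  assumes T: "pair_antisym6 T" and U: "pair_antisym6 U"
    and eq: "\<And>a b c d k l. (a, b) \<in> basis_pairs \<Longrightarrow> (c, d) \<in> basis_pairs \<Longrightarrow> (k, l) \<in> basis_pairs
      \<Longrightarrow> T a b c d k l = U a b c d k l"
  shows "T = U"
proof (intro ext)
  fix a b c d k l
  have "(\<lambda>a b c d. T a b c d k l) = (\<lambda>a b c d. U a b c d k l)" if "(k, l) \<in> basis_pairs" for k l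
    by (rule antisym4_eqI) (rule pair_antisym6D[OF T] pair_antisym6D[OF U] eq that; assumption?)+
  then have "T a b c d k l = U a b c d k l" if "(k, l) \<in> basis_pairs" for k l
    using that by meson
  then show "T a b c d k l = U a b c d k l"
    by (rule antisym_eqI[of "T a b c d" "U a b c d", OF pair_antisym6D(3)[OF T] pair_antisym6D(3)[OF U]])
qed

lemma pair_antisym4_warped_curv: "pair_antisym4 (warped_curv A B E K s)"
  unfolding pair_antisym4_def by (intro conjI allI warped_curv_antisym)

text \<open>For fixed last indices the operator acts on \<open>W\<close> slot by slot as a
  derivation, which preserves the antisymmetries of \<open>W\<close>; the one in the last pair comes
  from \<open>L\<close>.\<close>

lemma pair_antisym6_curv_dot:
  assumes L: "pair_antisym4 L" and W: "pair_antisym4 W"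
  shows "pair_antisym6 (curv_dot G L W)"
proof -
  have L2: "L e b l k = - L e b k l" for e b k l
    using pair_antisym4D(2)[OF L] .
  have W1: "W b a c d = - W a b c d" and W2: "W a b d c = - W a b c d" for a b c d
    using pair_antisym4D[OF W] by blast+
  have raise: "raise_first G L a b l k = - raise_first G L a b k l" for a b k l
    by (simp add: raise_first_def L2[of _ _ l k] sum_negf)
  show ?thesis
    unfolding pair_antisym6_def
  proof (intro conjI allI)
    fix a b c d k l
    show "curv_dot G L W b a c d k l = - curv_dot G L W a b c d k l"
      by (simp add: curv_dot_def sum_4 W1[of a b] W1[of a 1] W1[of a 2] W1[of a 3] W1[of a 4]
          W1[of 1 b] W1[of 2 b] W1[of 3 b] W1[of 4 b] algebra_simps)
    show "curv_dot G L W a b d c k l = - curv_dot G L W a b c d k l"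
      by (simp add: curv_dot_def sum_4 W2[of _ _ d c] W2[of _ _ 1 c] W2[of _ _ 2 c] W2[of _ _ 3 c]
          W2[of _ _ 4 c] W2[of _ _ d 1] W2[of _ _ d 2] W2[of _ _ d 3] W2[of _ _ d 4] algebra_simps)
    show "curv_dot G L W a b c d l k = - curv_dot G L W a b c d k l"
      by (simp add: curv_dot_def raise[of _ _ l k] sum_negf[symmetric] algebra_simps)
  qed
qed

lemma pair_antisym6_tachibana:
  assumes "pair_antisym4 W"
  shows "pair_antisym6 (tachibana B W)"
proof -
  have W1: "W b a c d = - W a b c d" and W2: "W a b d c = - W a b c d" for a b c d
    using pair_antisym4D[OF assms] by blast+
  show ?thesis
    unfolding pair_antisym6_def
  proof (intro conjI allI)
    fix a b c d k l
    show "tachibana B W b a c d k l = - tachibana B W a b c d k l"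
      unfolding tachibana_def using W1[of b a] W1[of k a] W1[of k b] W1[of l a] W1[of l b] by simp
    show "tachibana B W a b d c k l = - tachibana B W a b c d k l"
      unfolding tachibana_def
      using W2[of _ _ d c] W2[of _ _ k c] W2[of _ _ k d] W2[of _ _ l c] W2[of _ _ l d] by simp
    show "tachibana B W a b c d l k = - tachibana B W a b c d k l"
      unfolding tachibana_def by simp
  qed
qed

lemma pair_antisym6_add:
  "pair_antisym6 T \<Longrightarrow> pair_antisym6 U \<Longrightarrow> pair_antisym6 (\<lambda>a b c d k l. T a b c d k l + U a b c d k l)"
  unfolding pair_antisym6_def by (metis minus_add_distrib)

lemma pair_antisym6_scale:
  "pair_antisym6 T \<Longrightarrow> pair_antisym6 (\<lambda>a b c d k l. x * T a b c d k l)"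
  unfolding pair_antisym6_def by (metis mult_minus_right)

subsection \<open>The two identities at a point\<close>

context warped_metric_point
begin

text \<open>The shape of the Weyl tensor, which is of Petrov type D; \<open>c = u - v\<close> in the application.\<close>

definition type_D :: "real \<Rightarrow> 4 tensor4" where
  "type_D c = warped_curv (2 * c) (- (p * c * h)) (p * c) (- (2 * p\<^sup>2 * c)) s"

text \<open>Identity (i) at a point. As \<open>type_D\<close> is linear in \<open>c\<close>, both
  sides are quadratic in \<open>c\<close>.\<close>

lemma curv_dot_type_D:
  "curv_dot G (type_D c) (type_D c) = (\<lambda>a b e f k l. - c * tachibana G (type_D c) a b e f k l)"
proof (rule pair_antisym6_eqI)
  fix a b e f k l :: 4
  assume "(a, b) \<in> basis_pairs" "(e, f) \<in> basis_pairs" "(k, l) \<in> basis_pairs"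
  then show "curv_dot G (type_D c) (type_D c) a b e f k l = - c * tachibana G (type_D c) a b e f k l"
    unfolding basis_pairs_def
    by (elim insertE emptyE Pair_inject; hypsubst)
       (simp_all add: type_D_def curv_dot_def sum_4 raise_first_G warped_curv_table tachibana_def
         warped_symm_table p s field_simps power2_eq_square)
qed (simp_all only: type_D_def pair_antisym4_warped_curv pair_antisym6_curv_dot
      pair_antisym6_scale pair_antisym6_tachibana)

text \<open>The sum of \<open>3 * l\<close> times the metric, the trace-free electromagnetic part
  (\<open>- v\<close> times the metric on the (t, r)-plane, \<open>v\<close> times it on the sphere)
  and the null radiation term (2d/p) dt^2. The mass enters only through \<open>h\<close> and
  \<open>d\<close>.\<close>

definition ricci_model :: "real \<Rightarrow> real \<Rightarrow> real \<Rightarrow> real^4^4" where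
  "ricci_model l v d =
     warped_symm (2 * d / p - (v - 3 * l) * h) (v - 3 * l) (- (p * (3 * l + v))) s"

definition riemann_model :: "real \<Rightarrow> real \<Rightarrow> real \<Rightarrow> real \<Rightarrow> 4 tensor4" where
  "riemann_model l u v d =
     warped_curv (l + 2 * u - 3 * v) (d - p * (u - v - l) * h) (p * (u - v - l))
       (- (p\<^sup>2 * (l + 2 * u - v))) s"

text \<open>The rational factor is \<open>\<beta> (u - v)\<close>, which has no pole at \<open>u = v\<close>.\<close>

lemma curv_dot_riemann_model:
  "(\<lambda>a b e f k l'. curv_dot G (riemann_model l u v d) (riemann_model l u v d) a b e f k l'
     + (6 * l * (u - v) + 3 * u\<^sup>2 - 6 * u * v + 2 * v\<^sup>2) / 3 * tachibana G (type_D 1) a b e f k l')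
   = tachibana (ricci_model l v d) (riemann_model l u v d)" (is "?X = ?Y")
proof (rule pair_antisym6_eqI)
  fix a b e f k l' :: 4
  assume "(a, b) \<in> basis_pairs" "(e, f) \<in> basis_pairs" "(k, l') \<in> basis_pairs"
  then show "?X a b e f k l' = ?Y a b e f k l'"
    unfolding basis_pairs_def
    by (elim insertE emptyE Pair_inject; hypsubst)
       (simp_all add: type_D_def riemann_model_def ricci_model_def curv_dot_def sum_4 raise_first_G
         warped_curv_table tachibana_def warped_symm_table,
        simp_all add: p s,
        simp_all add: p s diff_divide_distrib add_divide_distrib ring_distribs,
        simp_all add: p s field_simps power2_eq_square)
qed (simp_all only: type_D_def riemann_model_def pair_antisym4_warped_curv pair_antisym6_curv_dot
      pair_antisym6_scale pair_antisym6_tachibana pair_antisym6_add)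

text \<open>Takes the factor u - v out of Q(g,C), where it meets the pole of \<beta>.\<close>

lemma tachibana_type_D: "tachibana B (type_D c) a b e f k l = c * tachibana B (type_D 1) a b e f k l"
proof -
  have "type_D c a b e f = c * type_D 1 a b e f" for a b e f
    by (simp add: type_D_def warped_curv_def algebra_simps)
  then show ?thesis
    by (simp add: tachibana_def algebra_simps)
qed

lemma ricci_contraction:
  "(\<chi> f k. \<Sum>e\<in>UNIV. \<Sum>t\<in>UNIV. matrix_inv G $ e $ t * riemann_model l u v d e f k t) = ricci_model l v d"
  using p s
  by (simp add: vec_eq_iff forall_4 matrix_inv_G riemann_model_def warped_curv_table sum_4
        ricci_model_def warped_symm_table; simp add: field_simps power2_eq_square)

text \<open>The radiation term has no trace because the component 11 of the inverse metric is 0, and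
  the electromagnetic part is trace-free.\<close>

lemma scalar_contraction:
  "(\<Sum>f\<in>UNIV. \<Sum>k\<in>UNIV. matrix_inv G $ f $ k * ricci_model l v d $ f $ k) = 12 * l"
  using p s
  by (simp add: sum_4 matrix_inv_G ricci_model_def warped_symm_table field_simps)

text \<open>The explicit terms in \<open>l\<close> and \<open>d\<close> cancel. The unsimplified
  \<open>(12 * l) / 12\<close> matches the scalar curvature over 12 in \<open>weyl\<close>.\<close>

lemma weyl_contraction:
  "riemann_model l u v d a b e f - 1 / 2 * kulkarni_nomizu G (ricci_model l v d) a b e f
     + (12 * l) / 12 * kulkarni_nomizu G G a b e f = type_D (u - v) a b e f"
  unfolding riemann_model_def ricci_model_def kulkarni_nomizu_warped_symm type_D_def warped_curv_def
  using p by (simp add: field_simps power2_eq_square)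

text \<open>All three values at 121313 are multiples of \<open>d\<close>, while those at 121323 do
  not involve \<open>d\<close>. The last right-hand side is 3 p \<beta> (u - v).\<close>

lemma model_components:
  fixes l u v d :: real
  defines "R \<equiv> riemann_model l u v d"
  shows "curv_dot G R R 1 2 1 3 1 3 = d * (l + 2 * u - 3 * v)"
    "tachibana (ricci_model l v d) R 1 2 1 3 1 3 = d * (l + 2 * u - 3 * v)"
    "tachibana G R 1 2 1 3 1 3 = d"
    "curv_dot G R R 1 2 1 3 2 3 = (l - u + v) * (p * (4 * v - 3 * u))"
    "tachibana G R 1 2 1 3 2 3 = p * (4 * v - 3 * u)"
    "curv_dot G R R 1 2 1 3 2 3 - tachibana (ricci_model l v d) R 1 2 1 3 2 3
       = p * (6 * l * (u - v) + 3 * u\<^sup>2 - 6 * u * v + 2 * v\<^sup>2)"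
  using p unfolding R_def riemann_model_def ricci_model_def curv_dot_def tachibana_def
  by (simp_all add: sum_4 raise_first_G warped_curv_table warped_symm_table field_simps power2_eq_square)

end

subsection \<open>Curvature of the metric\<close>

lemma partial_const [simp]: "partial k (\<lambda>y. c) x = 0"
  by (simp add: partial_def)

text \<open>Partial derivatives are local; this allows differentiating a formula for the Christoffel
  symbols that is known on \<open>M\<close> only.\<close>

lemma partial_cong:
  assumes "open M" "x \<in> M" and eq: "\<And>y. y \<in> M \<Longrightarrow> f y = g y"
  shows "partial k f x = partial k g x"
proof -
  have "((\<lambda>h. x + h *\<^sub>R axis k 1) \<longlongrightarrow> x + 0 *\<^sub>R axis k 1) (nhds 0)"
    by (intro tendsto_intros filterlim_ident)
  then have "\<forall>\<^sub>F h in nhds 0. x + h *\<^sub>R axis k 1 \<in> M"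
    using assms(1,2) by (auto dest: topological_tendstoD)
  then show ?thesis
    unfolding partial_def by (intro deriv_cong_ev) (auto elim: eventually_mono simp: eq)
qed

locale vbds_functions =
  fixes m q :: "real \<Rightarrow> real" and lam :: real
begin

definition H :: "real \<Rightarrow> real \<Rightarrow> real" where
  "H t r = 1 - 2 * m t / r + (q t)\<^sup>2 / r\<^sup>2 - lam * r\<^sup>2 / 3"

definition H_t :: "real \<Rightarrow> real \<Rightarrow> real" where
  "H_t t r = 2 * q t * deriv q t / r\<^sup>2 - 2 * deriv m t / r"

definition H_r :: "real \<Rightarrow> real \<Rightarrow> real" where
  "H_r t r = 2 * m t / r\<^sup>2 - 2 * (q t)\<^sup>2 / r ^ 3 - 2 * lam * r / 3"

definition H_tr :: "real \<Rightarrow> real \<Rightarrow> real" where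
  "H_tr t r = 2 * deriv m t / r\<^sup>2 - 4 * q t * deriv q t / r ^ 3"

definition H_rr :: "real \<Rightarrow> real \<Rightarrow> real" where
  "H_rr t r = 6 * (q t)\<^sup>2 / r ^ 4 - 4 * m t / r ^ 3 - 2 * lam / 3"

text \<open>The Christoffel symbols of the metric, with the upper index first.\<close>

definition Gamma :: "real \<Rightarrow> real \<Rightarrow> real \<Rightarrow> real^4^4^4" where
  "Gamma t r \<theta> = vector
    [vector [vector [H_r t r / 2, 0, 0, 0], vector [0, 0, 0, 0],
             vector [0, 0, - r, 0], vector [0, 0, 0, - (r * (sin \<theta>)\<^sup>2)]],
     vector [vector [(H t r * H_r t r - H_t t r) / 2, - (H_r t r / 2), 0, 0],
             vector [- (H_r t r / 2), 0, 0, 0],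
             vector [0, 0, - (r * H t r), 0], vector [0, 0, 0, - (r * H t r * (sin \<theta>)\<^sup>2)]],
     vector [vector [0, 0, 0, 0], vector [0, 0, 1 / r, 0],
             vector [0, 1 / r, 0, 0], vector [0, 0, 0, - (sin \<theta> * cos \<theta>)]],
     vector [vector [0, 0, 0, 0], vector [0, 0, 0, 1 / r],
             vector [0, 0, 0, cos \<theta> / sin \<theta>], vector [0, 1 / r, cos \<theta> / sin \<theta>, 0]]]"

abbreviation g :: "4 metric" where
  "g \<equiv> vbds_metric m q lam"

lemma g_eq:
  "g x = warped_symm (H (x $ 1) (x $ 2)) (- 1) (- (x $ 2)\<^sup>2) ((sin (x $ 3))\<^sup>2)"
  by (simp add: vbds_metric_def warped_symm_def H_def Let_def)

end

locale vbds_point = vbds_functions +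
  fixes t r \<theta> :: real
  assumes r: "r \<noteq> 0" and \<theta>: "sin \<theta> \<noteq> 0"
    and m: "m differentiable (at t)" and q: "q differentiable (at t)"
begin

lemma deriv_mq:
  "((\<lambda>h. m (t + h)) has_field_derivative deriv m t) (at 0)"
  "((\<lambda>h. q (t + h)) has_field_derivative deriv q t) (at 0)"
proof -
  have "(m has_field_derivative deriv m t) (at (0 + t))" "(q has_field_derivative deriv q t) (at (0 + t))"
    using m q by (simp_all add: DERIV_deriv_iff_real_differentiable)
  then show "((\<lambda>h. m (t + h)) has_field_derivative deriv m t) (at 0)"
    "((\<lambda>h. q (t + h)) has_field_derivative deriv q t) (at 0)"
    unfolding DERIV_shift by (simp_all add: add.commute)
qed

text \<open>No second t-derivative is among these: \<open>H_t\<close> occurs only in the symbol with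
  upper index 2 and lower indices 1, 1, and antisymmetry of the curvature means that this symbol is
  never differentiated along t.\<close>

lemma H_derivs:
  "((\<lambda>h. H (t + h) r) has_field_derivative H_t t r) (at 0)"
  "((\<lambda>h. H t (r + h)) has_field_derivative H_r t r) (at 0)"
  "((\<lambda>h. H_r (t + h) r) has_field_derivative H_tr t r) (at 0)"
  "((\<lambda>h. H_t t (r + h)) has_field_derivative H_tr t r) (at 0)"
  "((\<lambda>h. H_r t (r + h)) has_field_derivative H_rr t r) (at 0)"
  unfolding H_def H_t_def H_r_def H_tr_def H_rr_def using r
  by (auto intro!: derivative_eq_intros deriv_mq deriv_mq[unfolded add.commute[of t]]
      simp: field_simps power2_eq_square eval_nat_numeral)

text \<open>The left-hand sides have the form in which \<open>partial\<close> leaves the nonconstant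
  entries of the metric and of \<open>Gamma\<close>.\<close>

lemma deriv_table:
  "deriv (\<lambda>h. H (t + h) r) 0 = H_t t r"
  "deriv (\<lambda>h. H t (r + h)) 0 = H_r t r"
  "deriv (\<lambda>h. - (r + h)\<^sup>2) 0 = - 2 * r"
  "deriv (\<lambda>h. - ((r + h)\<^sup>2 * (sin \<theta>)\<^sup>2)) 0 = - 2 * r * (sin \<theta>)\<^sup>2"
  "deriv (\<lambda>h. - (r\<^sup>2 * (sin (\<theta> + h))\<^sup>2)) 0 = - 2 * r\<^sup>2 * sin \<theta> * cos \<theta>"
  "deriv (\<lambda>h. H_r (t + h) r / 2) 0 = H_tr t r / 2"
  "deriv (\<lambda>h. - (H_r (t + h) r / 2)) 0 = - H_tr t r / 2"
  "deriv (\<lambda>h. - (r * H (t + h) r)) 0 = - r * H_t t r"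
  "deriv (\<lambda>h. - (r * H (t + h) r * (sin \<theta>)\<^sup>2)) 0 = - r * H_t t r * (sin \<theta>)\<^sup>2"
  "deriv (\<lambda>h. H_r t (r + h) / 2) 0 = H_rr t r / 2"
  "deriv (\<lambda>h. - (H_r t (r + h) / 2)) 0 = - H_rr t r / 2"
  "deriv (\<lambda>h. - (r + h)) 0 = - 1"
  "deriv (\<lambda>h. - ((r + h) * (sin \<theta>)\<^sup>2)) 0 = - (sin \<theta>)\<^sup>2"
  "deriv (\<lambda>h. (H t (r + h) * H_r t (r + h) - H_t t (r + h)) / 2) 0
     = ((H_r t r)\<^sup>2 + H t r * H_rr t r - H_tr t r) / 2"
  "deriv (\<lambda>h. - ((r + h) * H t (r + h))) 0 = - H t r - r * H_r t r"
  "deriv (\<lambda>h. - ((r + h) * H t (r + h) * (sin \<theta>)\<^sup>2)) 0 = (- H t r - r * H_r t r) * (sin \<theta>)\<^sup>2"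
  "deriv (\<lambda>h. 1 / (r + h)) 0 = - 1 / r\<^sup>2"
  "deriv (\<lambda>h. - (r * (sin (\<theta> + h))\<^sup>2)) 0 = - 2 * r * sin \<theta> * cos \<theta>"
  "deriv (\<lambda>h. - (r * H t r * (sin (\<theta> + h))\<^sup>2)) 0 = - 2 * r * H t r * sin \<theta> * cos \<theta>"
  "deriv (\<lambda>h. - (sin (\<theta> + h) * cos (\<theta> + h))) 0 = (sin \<theta>)\<^sup>2 - (cos \<theta>)\<^sup>2"
  "deriv (\<lambda>h. cos (\<theta> + h) / sin (\<theta> + h)) 0 = - 1 - (cos \<theta> / sin \<theta>)\<^sup>2"
  by (rule DERIV_imp_deriv,
      (auto intro!: derivative_eq_intros H_derivs H_derivs[unfolded add.commute[of t] add.commute[of r]]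
        simp: r \<theta> field_simps power2_eq_square)[])+

end

context vbds_functions
begin

lemma partial_g:
  assumes "vbds_point m q (x $ 1) (x $ 2) (x $ 3)"
  shows "partial k (\<lambda>y. g y $ i $ j) x =
    (if k = 1 \<and> i = 1 \<and> j = 1 then H_t (x $ 1) (x $ 2)
     else if k = 2 \<and> i = 1 \<and> j = 1 then H_r (x $ 1) (x $ 2)
     else if k = 2 \<and> i = 3 \<and> j = 3 then - 2 * x $ 2
     else if k = 2 \<and> i = 4 \<and> j = 4 then - 2 * x $ 2 * (sin (x $ 3))\<^sup>2
     else if k = 3 \<and> i = 4 \<and> j = 4 then - 2 * (x $ 2)\<^sup>2 * sin (x $ 3) * cos (x $ 3)
     else 0)"
proof -
  interpret vbds_point m q lam "x $ 1" "x $ 2" "x $ 3" by fact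
  have "\<forall>k i j. partial k (\<lambda>y. g y $ i $ j) x =
    (if k = 1 \<and> i = 1 \<and> j = 1 then H_t (x $ 1) (x $ 2)
     else if k = 2 \<and> i = 1 \<and> j = 1 then H_r (x $ 1) (x $ 2)
     else if k = 2 \<and> i = 3 \<and> j = 3 then - 2 * x $ 2
     else if k = 2 \<and> i = 4 \<and> j = 4 then - 2 * x $ 2 * (sin (x $ 3))\<^sup>2
     else if k = 3 \<and> i = 4 \<and> j = 4 then - 2 * (x $ 2)\<^sup>2 * sin (x $ 3) * cos (x $ 3)
     else 0)"
    unfolding forall_4 by (simp add: g_eq warped_symm_table partial_def axis_def deriv_table)
  then show ?thesis by blast
qed

lemma christoffel_g:
  assumes "vbds_point m q (x $ 1) (x $ 2) (x $ 3)"
  shows "christoffel g x a i j = Gamma (x $ 1) (x $ 2) (x $ 3) $ a $ i $ j"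
proof -
  interpret vbds_point m q lam "x $ 1" "x $ 2" "x $ 3" by fact
  interpret warped_metric_point "H (x $ 1) (x $ 2)" "(x $ 2)\<^sup>2" "(sin (x $ 3))\<^sup>2"
    using r \<theta> by unfold_locales auto
  have "\<forall>a i j. christoffel g x a i j = Gamma (x $ 1) (x $ 2) (x $ 3) $ a $ i $ j"
    unfolding forall_4 christoffel_def partial_g[OF assms] unfolding g_eq sum_matrix_inv_G
    using r \<theta> by (simp add: Gamma_def; simp add: field_simps power2_eq_square)
  then show ?thesis by blast
qed

lemma sum_g:
  "(\<Sum>a\<in>UNIV. warped_symm x (- 1) c s $ 1 $ a * f a) = x * f 1 - f 2"
  "(\<Sum>a\<in>UNIV. warped_symm x (- 1) c s $ 2 $ a * f a) = - f 1"
  "(\<Sum>a\<in>UNIV. warped_symm x (- 1) c s $ 3 $ a * f a) = c * f 3"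
  "(\<Sum>a\<in>UNIV. warped_symm x (- 1) c s $ 4 $ a * f a) = c * s * f 4"
  by (simp_all add: sum_4 warped_symm_table)

lemma riemann_g:
  assumes "open M" "x \<in> M" and M: "\<forall>y\<in>M. vbds_point m q (y $ 1) (y $ 2) (y $ 3)"
  shows "riemann g x =
    (let t = x $ 1; r = x $ 2; h = H t r; s = (sin (x $ 3))\<^sup>2 in
      warped_curv (- (H_rr t r / 2)) ((r * H_t t r - r * h * H_r t r) / 2) (r * H_r t r / 2)
        (r\<^sup>2 * (h - 1)) s)"
proof -
  let ?t = "x $ 1" and ?r = "x $ 2" and ?\<theta> = "x $ 3"
  interpret vbds_point m q lam ?t ?r ?\<theta> using assms by blast
  have partial_christoffel: "partial k (\<lambda>y. christoffel g y a i j) x =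
      partial k (\<lambda>y. Gamma (y $ 1) (y $ 2) (y $ 3) $ a $ i $ j) x" for k a i j
    by (rule partial_cong[OF assms(1,2)]) (use christoffel_g M in blast)
  let ?R = "warped_curv (- (H_rr ?t ?r / 2)) ((?r * H_t ?t ?r - ?r * H ?t ?r * H_r ?t ?r) / 2)
      (?r * H_r ?t ?r / 2) (?r\<^sup>2 * (H ?t ?r - 1)) ((sin ?\<theta>)\<^sup>2)"
  have "riemann g x e f = ?R e f" for e f
  \<comment> \<open>Only antisymmetry in the last pair is evident from the definition of
    \<open>riemann\<close>, so \<open>e\<close> and \<open>f\<close> run over all values.\<close>
  proof (rule ext, rule ext, rule antisym_eqI)
    show "riemann g x e f l k = - riemann g x e f k l" for k l
      unfolding riemann_def sum_negf[symmetric] by (intro sum.cong) (auto simp: algebra_simps)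
    fix k l :: 4
    assume "(k, l) \<in> basis_pairs"
    moreover have "\<forall>e f. riemann g x e f k l = ?R e f k l" if "(k, l) \<in> basis_pairs"
      using that unfolding basis_pairs_def forall_4
      by (elim insertE emptyE Pair_inject; hypsubst)
         (simp_all add: riemann_def g_eq sum_g partial_christoffel christoffel_g[OF bspec[OF M assms(2)]],
          simp_all add: Gamma_def,
          simp_all add: partial_def axis_def deriv_table sum_4 warped_curv_table,
          simp_all add: r \<theta> field_simps power2_eq_square,
          simp add: distrib_left[symmetric] sin_cos_squared_add3)
    ultimately show "riemann g x e f k l = ?R e f k l" by blast
  qed (rule warped_curv_antisym)
  then show ?thesis by (auto simp: Let_def)
qed

lemma curvature_g:
  assumes "open M" "x \<in> M" "\<forall>y\<in>M. vbds_point m q (y $ 1) (y $ 2) (y $ 3)"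
    and tr: "t = x $ 1" "r = x $ 2" and h: "h = H t r" and s_eq: "s = (sin (x $ 3))\<^sup>2"
    and l: "l = lam / 3" and u: "u = m t / r ^ 3" and v: "v = (q t)\<^sup>2 / r ^ 4"
    and d: "d = (q t * deriv q t - r * deriv m t) / r"
  shows "warped_metric_point (r\<^sup>2) s"
    and "g x = warped_symm h (- 1) (- r\<^sup>2) s"
    and "riemann g x = warped_metric_point.riemann_model h (r\<^sup>2) s l u v d"
    and "ricci g x = warped_metric_point.ricci_model h (r\<^sup>2) s l v d"
    and "weyl g x = warped_metric_point.type_D h (r\<^sup>2) s (u - v)"
proof -
  interpret vbds_point m q lam t r "x $ 3" using assms(2,3) tr by blast
  show wmp: "warped_metric_point (r\<^sup>2) s"
    using r \<theta> s_eq by unfold_locales auto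
  then interpret warped_metric_point h "r\<^sup>2" s .
  show g: "g x = G"
    by (simp add: g_eq h s_eq tr)
  \<comment> \<open>The coefficients B, A, E, K of the two descriptions agree. In the first equation
    the third one has already been applied, as happens during unfolding.\<close>
  have "d - r * H_r t r / 2 * h = (r * H_t t r - r * h * H_r t r) / 2"
    and "l + 2 * u - 3 * v = - (H_rr t r / 2)"
    and "r\<^sup>2 * (u - v - l) = r * H_r t r / 2"
    and "- ((r\<^sup>2)\<^sup>2 * (l + 2 * u - v)) = r\<^sup>2 * (h - 1)"
    using r by (simp_all add: d u v l H_t_def H_r_def H_rr_def h H_def field_simps eval_nat_numeral)
  note params = this
  show R: "riemann g x = riemann_model l u v d"
    unfolding riemann_model_def params riemann_g[OF assms(1-3)]
    unfolding Let_def h s_eq tr by (rule refl)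
  show S: "ricci g x = ricci_model l v d"
    unfolding ricci_def g R by (rule ricci_contraction)
  have "scalar_curv g x = 12 * l"
    unfolding scalar_curv_def g S by (rule scalar_contraction)
  then show "weyl g x = type_D (u - v)"
    by (intro ext) (simp only: weyl_def R S g weyl_contraction)
qed

end

subsection \<open>Points in general position\<close>

lemma smooth_on_imp_differentiable:
  assumes "smooth_on U f" "x \<in> U"
  shows "f differentiable (at x)"
proof -
  have "Ck_on (Suc 0) U f"
    using assms(1) unfolding smooth_on_def by blast
  then show ?thesis
    using assms(2) by simp
qed

lemma open_image_vec_nth:
  fixes M :: "(real^'n::finite) set"
  assumes "open M"
  shows "open ((\<lambda>x. x $ i) ` M)"
proof (rule open_surjective_linear_image[OF assms])
  show "linear (\<lambda>x::real^'n. x $ i)"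
    by (simp add: bounded_linear.linear bounded_linear_vec_nth)
  show "surj (\<lambda>x::real^'n. x $ i)"
    by (rule surjI[where f = "\<lambda>c. \<chi> j. c"]) simp
qed

text \<open>Otherwise m and q^2 are constant on the connected set of values of t, and then so is q.
  The product q q' is used because \<open>d\<close> contains it.\<close>

lemma vbds_time_dependent_deriv:
  assumes M: "vbds_spacetime M m q" and dep: "vbds_time_dependent M m q"
  obtains x where "x \<in> M" "deriv m (x $ 1) \<noteq> 0 \<or> q (x $ 1) * deriv q (x $ 1) \<noteq> 0"
proof (rule ccontr)
  let ?T = "(\<lambda>x. x $ 1) ` M"
  assume "\<not> thesis"
  then have zero: "deriv m t = 0" "q t * deriv q t = 0" if "t \<in> ?T" for t
    using that \<open>\<And>x. x \<in> M \<Longrightarrow> _ \<Longrightarrow> thesis\<close> by blast+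
  have T: "open ?T" "connected ?T"
    using M unfolding vbds_spacetime_def
    by (auto intro!: open_image_vec_nth connected_continuous_image continuous_intros)
  have smooth: "smooth_on ?T m" "smooth_on ?T q"
    using M unfolding vbds_spacetime_def by blast+
  have D: "(m has_field_derivative deriv m t) (at t)" "(q has_field_derivative deriv q t) (at t)"
    if "t \<in> ?T" for t
    using smooth_on_imp_differentiable[OF smooth(1) that] smooth_on_imp_differentiable[OF smooth(2) that]
    by (simp_all add: DERIV_deriv_iff_real_differentiable)
  have cont: "continuous_on ?T m" "continuous_on ?T q"
    using smooth unfolding smooth_on_def by (metis Ck_on.simps(1))+
  have "m constant_on ?T"
    by (rule DERIV_zero_connected_constant_on[OF T(2,1) finite.emptyI cont(1)]) (use D zero in force)
  moreover have "(\<lambda>t. (q t)\<^sup>2) constant_on ?T"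
  proof (rule DERIV_zero_connected_constant_on[OF T(2,1) finite.emptyI])
    show "continuous_on ?T (\<lambda>t. (q t)\<^sup>2)"
      by (intro continuous_intros cont)
    show "\<forall>t\<in>?T - {}. ((\<lambda>t. (q t)\<^sup>2) has_field_derivative 0) (at t)"
    proof
      fix t
      assume "t \<in> ?T - {}"
      then have t: "t \<in> ?T"
        by simp
      have "((\<lambda>t. (q t)\<^sup>2) has_field_derivative 2 * (q t * deriv q t)) (at t)"
        by (auto intro!: derivative_eq_intros D(2)[OF t])
      then show "((\<lambda>t. (q t)\<^sup>2) has_field_derivative 0) (at t)"
        unfolding zero(2)[OF t] by simp
    qed
  qed
  then obtain c where c: "(q t)\<^sup>2 = c" if "t \<in> ?T" for t
    unfolding constant_on_def by blast
  \<comment> \<open>Two values remain for q; continuity on a connected set rules out a change of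
    sign.\<close>
  have "q ` ?T \<subseteq> {sqrt c, - sqrt c}"
  proof (rule image_subsetI)
    fix t
    assume "t \<in> ?T"
    then have "\<bar>q t\<bar> = sqrt c"
      using c by (metis real_sqrt_abs)
    then show "q t \<in> {sqrt c, - sqrt c}"
      by (auto simp: abs_if split: if_splits)
  qed
  then have "q constant_on ?T"
    using T(2) cont(2) by (intro continuous_finite_range_constant) (auto intro: finite_subset)
  ultimately show False
    using dep unfolding vbds_time_dependent_def by blast
qed

lemma vbds_generic_point:
  assumes M: "vbds_spacetime M m q" and dep: "vbds_time_dependent M m q"
    and nz: "\<forall>x\<in>M. (q (x $ 1))\<^sup>2 - x $ 2 * m (x $ 1) \<noteq> 0"
  obtains x where "x \<in> M"
    "q (x $ 1) * deriv q (x $ 1) - x $ 2 * deriv m (x $ 1) \<noteq> 0"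
    "4 * (q (x $ 1))\<^sup>2 - 3 * x $ 2 * m (x $ 1) \<noteq> 0"
    "lam / 3 * (x $ 2) ^ 4 + 2 * x $ 2 * m (x $ 1) - 3 * (q (x $ 1))\<^sup>2 \<noteq> 0"
    "2 * (x $ 2) ^ 5 * lam * m (x $ 1) + 3 * (x $ 2)\<^sup>2 * (m (x $ 1))\<^sup>2 - 2 * (x $ 2) ^ 4 * lam * (q (x $ 1))\<^sup>2
       - 6 * x $ 2 * m (x $ 1) * (q (x $ 1))\<^sup>2 + 2 * (q (x $ 1)) ^ 4 \<noteq> 0"
proof -
  obtain x where x: "x \<in> M" "deriv m (x $ 1) \<noteq> 0 \<or> q (x $ 1) * deriv q (x $ 1) \<noteq> 0"
    using vbds_time_dependent_deriv[OF M dep] .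
  define m0 q0 m1 q1 where "m0 = m (x $ 1)" "q0 = q (x $ 1)" "m1 = deriv m (x $ 1)" "q1 = deriv q (x $ 1)"
  \<comment> \<open>The assumption q^2 \<noteq> r m excludes m = q = 0.\<close>
  have m0q0: "m0 \<noteq> 0 \<or> q0 \<noteq> 0"
    using nz x(1) unfolding m0_q0_m1_q1_def by force
  \<comment> \<open>The four conditions as polynomials in r at fixed t, with coefficients in
    increasing degree.\<close>
  define P1 P2 P3 P4 where "P1 = [:q0 * q1, - m1:]" "P2 = [:4 * q0\<^sup>2, - (3 * m0):]"
    "P3 = [:- (3 * q0\<^sup>2), 2 * m0, 0, 0, lam / 3:]"
    "P4 = [:2 * q0 ^ 4, - (6 * m0 * q0\<^sup>2), 3 * m0\<^sup>2, 0, - (2 * lam * q0\<^sup>2), 2 * lam * m0:]"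
  note P = P1_P2_P3_P4_def
  have "P1 \<noteq> 0"
    using x(2) unfolding P m0_q0_m1_q1_def by auto
  \<comment> \<open>Each has among its coefficients nonzero multiples of a power of
    \<open>q0\<close> and of a power of \<open>m0\<close>, both free of \<open>lam\<close>.\<close>
  moreover have "P2 \<noteq> 0" "P3 \<noteq> 0" "P4 \<noteq> 0"
    using m0q0 unfolding P by auto
  ultimately have "P1 * P2 * P3 * P4 \<noteq> 0"
    by simp
  then have "finite {r. poly (P1 * P2 * P3 * P4) r = 0}"
    by (rule poly_roots_finite)
  obtain e where e: "e > 0" "ball x e \<subseteq> M"
    using M x(1) unfolding vbds_spacetime_def by (meson openE)
  have "infinite {x $ 2<..<x $ 2 + e}"
    using e(1) by (simp add: infinite_Ioo)
  then obtain r where r: "r \<in> {x $ 2<..<x $ 2 + e}" "poly (P1 * P2 * P3 * P4) r \<noteq> 0"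
    using \<open>finite {r. poly (P1 * P2 * P3 * P4) r = 0}\<close> by (metis (mono_tags, lifting) mem_Collect_eq rev_finite_subset subsetI)
  \<comment> \<open>Only r moves, so m, q and their derivatives keep their values.\<close>
  define y where "y = x + (r - x $ 2) *\<^sub>R axis 2 1"
  have "y \<in> ball x e"
    using r(1) by (simp add: y_def dist_norm norm_axis_1)
  moreover have "y $ 1 = x $ 1" "y $ 2 = r"
    by (simp_all add: y_def axis_def)
  moreover have "poly P1 r \<noteq> 0" "poly P2 r \<noteq> 0" "poly P3 r \<noteq> 0" "poly P4 r \<noteq> 0"
    using r(2) by simp_all
  then have "q0 * q1 - r * m1 \<noteq> 0" "4 * q0\<^sup>2 - 3 * r * m0 \<noteq> 0" "lam / 3 * r ^ 4 + 2 * r * m0 - 3 * q0\<^sup>2 \<noteq> 0"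
    "2 * r ^ 5 * lam * m0 + 3 * r\<^sup>2 * m0\<^sup>2 - 2 * r ^ 4 * lam * q0\<^sup>2 - 6 * r * m0 * q0\<^sup>2 + 2 * q0 ^ 4 \<noteq> 0"
    unfolding P by (simp_all add: algebra_simps eval_nat_numeral)
  ultimately show thesis
    using that[of y] e(2) unfolding m0_q0_m1_q1_def by (metis subsetD)
qed

text \<open>Here \<mu> = m(t) and e = q(t). Numerators one, two and four are kept nonzero at the
  generic point; dividing the fourth expression by three times the third gives \<beta>.\<close>

lemma curvature_parameters:
  fixes r \<mu> e lam :: real
  assumes r: "r \<noteq> 0" and l: "l = lam / 3" and u: "u = \<mu> / r ^ 3" and v: "v = e\<^sup>2 / r ^ 4"
  shows "l + 2 * u - 3 * v = (lam / 3 * r ^ 4 + 2 * r * \<mu> - 3 * e\<^sup>2) / r ^ 4"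
    and "4 * v - 3 * u = (4 * e\<^sup>2 - 3 * r * \<mu>) / r ^ 4"
    and "u - v = (r * \<mu> - e\<^sup>2) / r ^ 4"
    and "6 * l * (u - v) + 3 * u\<^sup>2 - 6 * u * v + 2 * v\<^sup>2
      = (2 * r ^ 5 * lam * \<mu> + 3 * r\<^sup>2 * \<mu>\<^sup>2 - 2 * r ^ 4 * lam * e\<^sup>2 - 6 * r * \<mu> * e\<^sup>2 + 2 * e ^ 4) / r ^ 8"
  using r by (simp_all add: l u v field_simps eval_nat_numeral)

theorem proposition3p5:
  fixes m q :: "real \<Rightarrow> real" and lam :: real and M :: "(real^4) set"
    and g :: "real^4 \<Rightarrow> real^4^4"
  assumes "g = vbds_metric m q lam"
    and "vbds_spacetime M m q"
    and "\<forall>x\<in>M. (q (x $ 1))\<^sup>2 - x $ 2 * m (x $ 1) \<noteq> 0"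
  shows "(vbds_time_dependent M m q \<longrightarrow>
            \<not> ricci_gen_pseudosymmetric_on M g \<and> \<not> pseudosymmetric_on M g)
     \<and> (\<forall>x\<in>M. \<forall>b1 b2 b3 b4 k l.
           (let r = x $ 2; mt = m (x $ 1); qt = q (x $ 1)
            in curv_dot (g x) (weyl g x) (weyl g x) b1 b2 b3 b4 k l
               = - ((r * mt - qt\<^sup>2) / r ^ 4) * tachibana (g x) (weyl g x) b1 b2 b3 b4 k l))
     \<and> (\<forall>x\<in>M. \<forall>b1 b2 b3 b4 k l.
           (let r = x $ 2; mt = m (x $ 1); qt = q (x $ 1);
                \<beta> = (2 * r ^ 5 * lam * mt + 3 * r\<^sup>2 * mt\<^sup>2 - 2 * r ^ 4 * lam * qt\<^sup>2
                     - 6 * r * mt * qt\<^sup>2 + 2 * qt ^ 4) / (3 * r ^ 4 * (r * mt - qt\<^sup>2))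
            in curv_dot (g x) (riemann g x) (riemann g x) b1 b2 b3 b4 k l
               + \<beta> * tachibana (g x) (weyl g x) b1 b2 b3 b4 k l
               = tachibana (ricci g x) (riemann g x) b1 b2 b3 b4 k l))"
proof (intro conjI impI ballI allI)
  note M = assms(2)
  have "open M"
    using M by (simp add: vbds_spacetime_def)
  have r: "x $ 2 > 0" if "x \<in> M" for x
    using M that by (simp add: vbds_spacetime_def)
  have "vbds_point m q (x $ 1) (x $ 2) (x $ 3)" if "x \<in> M" for x
  proof
    show "x $ 2 \<noteq> 0" "sin (x $ 3) \<noteq> 0"
      using M that sin_gt_zero[of "x $ 3"] by (auto simp: vbds_spacetime_def)
    show "m differentiable (at (x $ 1))" "q differentiable (at (x $ 1))"
      using M that by (auto simp: vbds_spacetime_def intro: smooth_on_imp_differentiable)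
  qed
  then have point: "\<forall>x\<in>M. vbds_point m q (x $ 1) (x $ 2) (x $ 3)"
    by blast
  \<comment> \<open>The eight instances of \<open>refl\<close> substitute the values of the
    parameters at the point.\<close>
  note curvature = vbds_functions.curvature_g[where m = m and q = q and lam = lam, folded assms(1), OF \<open>open M\<close> _ point
      refl refl refl refl refl refl refl refl]
  {
    assume "vbds_time_dependent M m q"
    then obtain x where x: "x \<in> M"
      "q (x $ 1) * deriv q (x $ 1) - x $ 2 * deriv m (x $ 1) \<noteq> 0"
      "4 * (q (x $ 1))\<^sup>2 - 3 * x $ 2 * m (x $ 1) \<noteq> 0"
      "lam / 3 * (x $ 2) ^ 4 + 2 * x $ 2 * m (x $ 1) - 3 * (q (x $ 1))\<^sup>2 \<noteq> 0"
      "2 * (x $ 2) ^ 5 * lam * m (x $ 1) + 3 * (x $ 2)\<^sup>2 * (m (x $ 1))\<^sup>2 - 2 * (x $ 2) ^ 4 * lam * (q (x $ 1))\<^sup>2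
         - 6 * x $ 2 * m (x $ 1) * (q (x $ 1))\<^sup>2 + 2 * (q (x $ 1)) ^ 4 \<noteq> 0"
      using vbds_generic_point[OF M _ assms(3)] by metis
    define l u v d where "l = lam / 3" and "u = m (x $ 1) / (x $ 2) ^ 3" and "v = (q (x $ 1))\<^sup>2 / (x $ 2) ^ 4"
      and "d = (q (x $ 1) * deriv q (x $ 1) - x $ 2 * deriv m (x $ 1)) / x $ 2"
    note luvd = this
    interpret warped_metric_point "vbds_functions.H m q lam (x $ 1) (x $ 2)" "(x $ 2)\<^sup>2" "(sin (x $ 3))\<^sup>2"
      by (rule curvature(1)[OF x(1)])
    note cx = curvature(2-4)[OF x(1), folded luvd]
    note components = model_components[where l = l and u = u and v = v and d = d, folded cx]
    have d: "d \<noteq> 0" and A: "l + 2 * u - 3 * v \<noteq> 0" and X: "4 * v - 3 * u \<noteq> 0"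
      and N: "6 * l * (u - v) + 3 * u\<^sup>2 - 6 * u * v + 2 * v\<^sup>2 \<noteq> 0"
      using x r[OF x(1)] by (simp_all add: curvature_parameters(1,2,4)[OF _ luvd(1-3)] luvd(4))
    show "\<not> ricci_gen_pseudosymmetric_on M g"
    proof
      assume "ricci_gen_pseudosymmetric_on M g"
      \<comment> \<open>By the component 121313, the point lies in the set where the condition is
        imposed.\<close>
      moreover have "tachibana (ricci g x) (riemann g x) \<noteq> (\<lambda>b1 b2 b3 b4 r s. 0)"
        using components(2) d A by (intro notI) simp
      ultimately obtain F where F: "curv_dot (g x) (riemann g x) (riemann g x) b1 b2 b3 b4 k l
          = F x * tachibana (ricci g x) (riemann g x) b1 b2 b3 b4 k l" for b1 b2 b3 b4 k l
        using x(1) unfolding ricci_gen_pseudosymmetric_on_def Let_def by blast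
      have "F x = 1"
        using F[of 1 2 1 3 1 3] d A unfolding components(1,2) by simp
      \<comment> \<open>With F = 1 the component 121323 forces the expression in \<open>N\<close> to
        vanish.\<close>
      then show False
        using F[of 1 2 1 3 2 3] components(6) N p by simp
    qed
    show "\<not> pseudosymmetric_on M g"
    proof
      assume "pseudosymmetric_on M g"
      moreover have "tachibana (g x) (riemann g x) \<noteq> (\<lambda>b1 b2 b3 b4 r s. 0)"
        using components(3) d by (intro notI) simp
      ultimately obtain F where F: "curv_dot (g x) (riemann g x) (riemann g x) b1 b2 b3 b4 k l
          = F x * tachibana (g x) (riemann g x) b1 b2 b3 b4 k l" for b1 b2 b3 b4 k l
        using x(1) unfolding pseudosymmetric_on_def Let_def by blast
      have "F x = l + 2 * u - 3 * v"
        using F[of 1 2 1 3 1 3] d unfolding components(1,3) by simp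
      moreover have "F x = l - u + v"
        using F[of 1 2 1 3 2 3] X p unfolding components(4,5) by simp
      \<comment> \<open>Equating the two values gives 3u = 4v.\<close>
      ultimately show False
        using X by simp
    qed
  }
  fix x b1 b2 b3 b4 k k'
  assume x: "x \<in> M"
  define l u v d where "l = lam / 3" and "u = m (x $ 1) / (x $ 2) ^ 3" and "v = (q (x $ 1))\<^sup>2 / (x $ 2) ^ 4"
    and "d = (q (x $ 1) * deriv q (x $ 1) - x $ 2 * deriv m (x $ 1)) / x $ 2"
  note luvd = this
  interpret warped_metric_point "vbds_functions.H m q lam (x $ 1) (x $ 2)" "(x $ 2)\<^sup>2" "(sin (x $ 3))\<^sup>2"
    by (rule curvature(1)[OF x])
  note cx = curvature(2-5)[OF x, folded luvd]
  have c: "u - v = (x $ 2 * m (x $ 1) - (q (x $ 1))\<^sup>2) / (x $ 2) ^ 4"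
    using r[OF x] by (intro curvature_parameters(3)[OF _ luvd(1-3)]) simp
  show "let r = x $ 2; mt = m (x $ 1); qt = q (x $ 1)
    in curv_dot (g x) (weyl g x) (weyl g x) b1 b2 b3 b4 k k'
       = - ((r * mt - qt\<^sup>2) / r ^ 4) * tachibana (g x) (weyl g x) b1 b2 b3 b4 k k'"
    unfolding Let_def cx c[symmetric] curv_dot_type_D by (rule refl)
  let ?N = "2 * (x $ 2) ^ 5 * lam * m (x $ 1) + 3 * (x $ 2)\<^sup>2 * (m (x $ 1))\<^sup>2 - 2 * (x $ 2) ^ 4 * lam * (q (x $ 1))\<^sup>2
     - 6 * x $ 2 * m (x $ 1) * (q (x $ 1))\<^sup>2 + 2 * (q (x $ 1)) ^ 4"
  let ?\<beta> = "?N / (3 * (x $ 2) ^ 4 * (x $ 2 * m (x $ 1) - (q (x $ 1))\<^sup>2))"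
  have nz: "x $ 2 * m (x $ 1) - (q (x $ 1))\<^sup>2 \<noteq> 0"
    using assms(3) x by force
  \<comment> \<open>The factor r m - q^2 in the denominator of \<beta> cancels against u -
    v.\<close>
  have "?\<beta> * (u - v) = ?N / (3 * (x $ 2) ^ 8)"
    unfolding c using nz r[OF x] by (simp add: divide_simps)
  also have "\<dots> = (6 * l * (u - v) + 3 * u\<^sup>2 - 6 * u * v + 2 * v\<^sup>2) / 3"
    using r[OF x] by (simp add: curvature_parameters(4)[OF _ luvd(1-3)])
  finally have "?\<beta> * (u - v) = (6 * l * (u - v) + 3 * u\<^sup>2 - 6 * u * v + 2 * v\<^sup>2) / 3" .
  then have *: "?\<beta> * tachibana G (type_D (u - v)) b1 b2 b3 b4 k k'
      = (6 * l * (u - v) + 3 * u\<^sup>2 - 6 * u * v + 2 * v\<^sup>2) / 3 * tachibana G (type_D 1) b1 b2 b3 b4 k k'"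
    by (simp only: tachibana_type_D[where c = "u - v"] mult.assoc[symmetric])
  show "let r = x $ 2; mt = m (x $ 1); qt = q (x $ 1);
      \<beta> = (2 * r ^ 5 * lam * mt + 3 * r\<^sup>2 * mt\<^sup>2 - 2 * r ^ 4 * lam * qt\<^sup>2
           - 6 * r * mt * qt\<^sup>2 + 2 * qt ^ 4) / (3 * r ^ 4 * (r * mt - qt\<^sup>2))
    in curv_dot (g x) (riemann g x) (riemann g x) b1 b2 b3 b4 k k'
       + \<beta> * tachibana (g x) (weyl g x) b1 b2 b3 b4 k k'
       = tachibana (ricci g x) (riemann g x) b1 b2 b3 b4 k k'"
    unfolding Let_def cx * by (rule curv_dot_riemann_model[THEN fun_cong, THEN fun_cong, THEN fun_cong,
          THEN fun_cong, THEN fun_cong, THEN fun_cong])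
qed

end
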